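(* Let $G$ be an infinite prime graph. If all chains in the neighborhood lattice $\widehat{N(G)}$ are finite, then $G$ embeds $G_2$ or $G_3$.
   Context: Graphs are undirected, simple and without loops (possibly infinite). A graph $G=(V,\mathcal E)$ embeds a graph $G'$ if $G'$ is isomorphic to an induced subgraph of $G$. A subset $A\subseteq V$ is autonomous in $G$ if every $v\in V\setminus A$ is either adjacent to all vertices of $A$ or adjacent to no vertex of $A$. The empty set, the singletons and $V$ are the trivial autonomous sets. $G$ is prime if it has more than three vertices and all its autonomous sets are trivial. For $x\in V$, $N_G(x)=\{y\in V:\{x,y\}\in\mathcal E\}$. The neighborhood lattice $\widehat{N(G)}$ is the set of all intersections of subfamilies of $\{N_G(x): x\in V\}$ (with the intersection of the empty family equal to $V$), ordered by inclusion. Let $A=\{a_i: i\in\mathbb N\}$ and $B=\{b_i: i\in\mathbb N\}$ be disjoint (all listed vertices distinct). $G_2$ has vertex set $A\cup B$ and its edges are the pairs $\{a_i,b_j\}$ with $j=i$ or $j=i+1$ (so $G_2$ is the one-way infinite path). $G_3$ has vertex set $A\cup B\cup\{c\}$ with $c$ a new vertex, and its edges are the pairs $\{a_i,b_i\}$ and $\{c,b_i\}$, $i\in\mathbb N$. *)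

theory Defs
  imports Main
begin

record 'v graph =
  verts :: "'v set"
  edges :: "'v set set"

definition simple_graph :: "'v graph \<Rightarrow> bool" where
  "simple_graph G \<longleftrightarrow>
     (\<forall>e\<in>edges G. \<exists>x\<in>verts G. \<exists>y\<in>verts G. x \<noteq> y \<and> e = {x, y})"

definition adjacent :: "'v graph \<Rightarrow> 'v \<Rightarrow> 'v \<Rightarrow> bool" where
  "adjacent G x y \<longleftrightarrow> {x, y} \<in> edges G"

definition induced_subgraph :: "'v graph \<Rightarrow> 'v set \<Rightarrow> 'v graph" where
  "induced_subgraph G W = \<lparr>verts = W, edges = {e \<in> edges G. e \<subseteq> W}\<rparr>"

definition graph_isomorphic :: "'v graph \<Rightarrow> 'w graph \<Rightarrow> bool" where
  "graph_isomorphic G H \<longleftrightarrow>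
     (\<exists>f. bij_betw f (verts G) (verts H) \<and>
          (\<forall>x\<in>verts G. \<forall>y\<in>verts G. adjacent G x y \<longleftrightarrow> adjacent H (f x) (f y)))"

definition embeds :: "'v graph \<Rightarrow> 'w graph \<Rightarrow> bool" where
  "embeds G H \<longleftrightarrow> (\<exists>W\<subseteq>verts G. graph_isomorphic H (induced_subgraph G W))"

definition autonomous :: "'v graph \<Rightarrow> 'v set \<Rightarrow> bool" where
  "autonomous G A \<longleftrightarrow>
     A \<subseteq> verts G \<and>
     (\<forall>v\<in>verts G - A. (\<forall>a\<in>A. adjacent G v a) \<or> (\<forall>a\<in>A. \<not> adjacent G v a))"

text \<open>The cardinality of an infinite set is 0 in HOL, so infinite vertex sets are
  admitted by a separate disjunct.\<close>

definition prime_graph :: "'v graph \<Rightarrow> bool" where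
  "prime_graph G \<longleftrightarrow>
     (infinite (verts G) \<or> card (verts G) > 3) \<and>
     (\<forall>A. autonomous G A \<longrightarrow> A = {} \<or> (\<exists>v. A = {v}) \<or> A = verts G)"

definition neighborhood :: "'v graph \<Rightarrow> 'v \<Rightarrow> 'v set" where
  "neighborhood G x = {y \<in> verts G. {x, y} \<in> edges G}"

text \<open>Intersecting with \<^term>\<open>verts G\<close> only matters for the empty family, whose
  intersection is thereby \<^term>\<open>verts G\<close> and not \<^term>\<open>UNIV\<close>.\<close>

definition neighborhood_lattice :: "'v graph \<Rightarrow> 'v set set" where
  "neighborhood_lattice G =
     {verts G \<inter> \<Inter>F | F. F \<subseteq> neighborhood G ` verts G}"

datatype vertex = VA nat | VB nat | VC

definition G2 :: "vertex graph" where
  "G2 = \<lparr>verts = range VA \<union> range VB,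
         edges = {{VA i, VB j} | i j. j = i \<or> j = i + 1}\<rparr>"

definition G3 :: "vertex graph" where
  "G3 = \<lparr>verts = range VA \<union> range VB \<union> {VC},
         edges = {{VA i, VB i} | i. True} \<union> {{VC, VB i} | i. True}\<rparr>"

lemma simple_graph_G2: "simple_graph G2"
  by (fastforce simp: simple_graph_def G2_def)

lemma simple_graph_G3: "simple_graph G3"
  by (fastforce simp: simple_graph_def G3_def)

end

theory Submission
  imports Defs "HOL-Library.Ramsey"
begin

text \<open>
  Let \<open>P\<close> be a minimal infinite element of the neighborhood lattice and let \<open>Q\<close> be the set of
  vertices adjacent to all of \<open>P\<close>. By minimality every vertex outside \<open>Q\<close>, in particular
  every vertex of \<open>P\<close>, has only finitely many neighbors in \<open>P\<close>. If \<open>G[P]\<close> has an infinite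
  component, a geodesic ray in it is an induced copy of \<open>G\<^sub>2\<close>. Otherwise primality forces infinitely
  many \<open>x \<in> P\<close> to have a neighbor \<open>v\<^sub>x\<close> outside \<open>P \<union> Q\<close>: a component of \<open>G[P]\<close> without such an \<open>x\<close>
  is autonomous, hence a singleton, and two such singletons form an autonomous pair.
  Since \<open>P\<close> is the intersection of finitely many neighborhoods, infinitely many of these \<open>v\<^sub>x\<close> miss
  the same \<open>c \<in> Q\<close>. Ramsey's theorem makes the \<open>x\<close> and the \<open>v\<^sub>x\<close> a half graph or a matching, and the
  \<open>v\<^sub>x\<close> a clique or independent; half graphs and cliques yield infinite chains, so \<open>c\<close>, the \<open>x\<close> and
  the \<open>v\<^sub>x\<close> induce a copy of \<open>G\<^sub>3\<close>.
\<close>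

section \<open>Infinite combinatorics: Ramsey, Koenig and chain conditions\<close>

lemma ramsey_subsequence:
  fixes P :: "nat \<Rightarrow> nat \<Rightarrow> bool"
  obtains r :: "nat \<Rightarrow> nat" where "strict_mono r" "\<forall>i j. i < j \<longrightarrow> P (r i) (r j)"
  | r :: "nat \<Rightarrow> nat" where "strict_mono r" "\<forall>i j. i < j \<longrightarrow> \<not> P (r i) (r j)"
proof -
  \<comment> \<open>Ramsey's theorem colors unordered pairs, whereas \<open>P\<close> need not be
    symmetric; \<open>Min\<close> and \<open>Max\<close> recover the order of a pair.\<close>
  define f :: "nat set \<Rightarrow> nat" where "f A = of_bool (P (Min A) (Max A))" for A
  have "\<exists>Y t. Y \<subseteq> (UNIV :: nat set) \<and> infinite Y \<and> t < 2
      \<and> (\<forall>x\<in>Y. \<forall>y\<in>Y. x \<noteq> y \<longrightarrow> f {x, y} = t)"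
    by (rule Ramsey2) (auto simp: f_def)
  then obtain Y t where Y: "infinite Y" "t < 2"
    and f: "\<And>x y. x \<in> Y \<Longrightarrow> y \<in> Y \<Longrightarrow> x \<noteq> y \<Longrightarrow> f {x, y} = t"
    by blast
  define r where "r = enumerate Y"
  have r: "strict_mono r"
    using Y by (simp add: r_def strict_mono_enumerate)
  have eq: "of_bool (P (r i) (r j)) = t" if "i < j" for i j
  proof -
    have lt: "r i < r j"
      using r that by (simp add: strict_mono_less)
    moreover have "r i \<in> Y" "r j \<in> Y"
      using Y by (simp_all add: r_def enumerate_in_set)
    ultimately show ?thesis
      using f[of "r i" "r j"] by (simp add: f_def)
  qed
  show ?thesis
  proof (cases "t = 0")
    case True
    then have "\<forall>i j. i < j \<longrightarrow> \<not> P (r i) (r j)"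
      using eq by simp
    then show ?thesis
      by (rule that(2)[OF r])
  next
    case False
    then have "P (r i) (r j)" if "i < j" for i j
      using eq[OF that] by (cases "P (r i) (r j)") auto
    then show ?thesis
      using that(1)[OF r] by blast
  qed
qed

text \<open>Koenig's lemma is applied only to the edges that lead one step away from
  \<open>x\<close>. Along the resulting ray the distance from \<open>x\<close> equals the index, and
  an edge changes the distance by at most one, so the ray has no chords.\<close>

lemma koenig_induced_ray:
  fixes R :: "('a \<times> 'a) set"
  assumes "sym R" and "irrefl R" and fin: "\<And>y. finite (R `` {y})"
    and inf: "infinite (R\<^sup>* `` {x})"
  obtains r :: "nat \<Rightarrow> 'a"
  where "inj r" "\<And>i j. (r i, r j) \<in> R \<longleftrightarrow> j = Suc i \<or> i = Suc j"
proof -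
  \<comment> \<open>\<open>d\<close> is the distance from \<open>x\<close>, with an irrelevant
    default at unreachable points; \<open>D\<close> consists of the edges pointing away from
    \<open>x\<close>.\<close>
  define d where "d z = (LEAST n. (x, z) \<in> R ^^ n)" for z
  define D where "D = {(u, w) \<in> R. d w = Suc (d u)}"
  have d_le: "d z \<le> n" if "(x, z) \<in> R ^^ n" for z n
    unfolding d_def using that by (rule Least_le)
  have d_walk: "(x, z) \<in> R ^^ d z" if "(x, z) \<in> R\<^sup>*" for z
    unfolding d_def using that by (metis LeastI rtrancl_imp_relpow)
  have d_step: "d w \<le> Suc (d u)" if "(x, u) \<in> R\<^sup>*" "(u, w) \<in> R" for u w
    using d_le[of w "Suc (d u)"] d_walk[OF that(1)] that(2) by auto
  have reach: "(x, z) \<in> D\<^sup>*" if "(x, z) \<in> R\<^sup>*" "d z = n" for z n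
    using that
  proof (induction n arbitrary: z)
    case 0
    then show ?case using d_walk[of z] by auto
  next
    case (Suc n)
    then obtain u where u: "(x, u) \<in> R ^^ n" "(u, z) \<in> R"
      using d_walk[of z] by auto
    then have ru: "(x, u) \<in> R\<^sup>*"
      by (simp add: relpow_imp_rtrancl)
    have "d u = n"
      using d_le[OF u(1)] d_step[OF ru u(2)] Suc.prems by simp
    then show ?case
      using Suc ru u(2) by (auto simp: D_def intro: rtrancl_into_rtrancl)
  qed
  have "infinite (D\<^sup>* `` {x})"
    using inf reach by (metis (no_types, lifting) Image_singleton_iff finite_subset subsetI)
  \<comment> \<open>What is reachable from \<open>u\<close> is \<open>u\<close> itself and what is
    reachable from its finitely many \<open>D\<close>-successors, so one successor inherits
    infinity.\<close>
  moreover have "\<exists>w. (u, w) \<in> D \<and> infinite (D\<^sup>* `` {w})" if "infinite (D\<^sup>* `` {u})" for u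
  proof (rule ccontr)
    assume "\<not> ?thesis"
    moreover have "D `` {u} \<subseteq> R `` {u}"
      by (auto simp: D_def)
    ultimately have "finite (insert u (\<Union>w\<in>D `` {u}. D\<^sup>* `` {w}))"
      using fin finite_subset by (metis (no_types, lifting) Image_singleton_iff finite_UN finite_insert)
    moreover have "D\<^sup>* `` {u} \<subseteq> insert u (\<Union>w\<in>D `` {u}. D\<^sup>* `` {w})"
      by (auto elim: converse_rtranclE)
    ultimately show False
      using that finite_subset by blast
  qed
  ultimately obtain r where r0: "r 0 = x" and r: "\<And>n. infinite (D\<^sup>* `` {r n})"
    and rD: "\<And>n. (r n, r (Suc n)) \<in> D"
    using dependent_nat_choice[of "\<lambda>n u. infinite (D\<^sup>* `` {u}) \<and> (n = 0 \<longrightarrow> u = x)" "\<lambda>_ u w. (u, w) \<in> D"]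
    by (metis nat.distinct(1))
  have rR: "(r n, r (Suc n)) \<in> R" for n
    using rD by (auto simp: D_def)
  have d_r: "d (r n) = n" for n
  proof (induction n)
    case 0
    then show ?case using d_le[of x 0] r0 by simp
  next
    case (Suc n)
    then show ?case using rD[of n] by (simp add: D_def)
  qed
  have r_reach: "(x, r n) \<in> R\<^sup>*" for n
    by (induction n) (auto simp: r0 intro: rtrancl_into_rtrancl rR)
  show ?thesis
  proof
    show "inj r"
      by (metis d_r injI)
    show "(r i, r j) \<in> R \<longleftrightarrow> j = Suc i \<or> i = Suc j" for i j
    proof
      assume ij: "(r i, r j) \<in> R"
      then have "j \<le> Suc i" "i \<le> Suc j" "i \<noteq> j"
        using d_step[OF r_reach ij] d_step[OF r_reach, of j "r i"] \<open>sym R\<close> \<open>irrefl R\<close>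
        by (auto simp: d_r dest: symD irreflD)
      then show "j = Suc i \<or> i = Suc j"
        by linarith
    qed (use rR \<open>sym R\<close> in \<open>auto dest: symD\<close>)
  qed
qed

text \<open>The range of a strictly descending sequence in \<open>L\<close> would be an infinite
  chain.\<close>

lemma wf_psubset_if_finite_chains:
  assumes "\<And>C. C \<in> chains L \<Longrightarrow> finite C"
  shows "wf {(A, B). A \<in> L \<and> B \<in> L \<and> A \<subset> B}"
  unfolding wf_iff_no_infinite_down_chain
proof
  assume "\<exists>f. \<forall>i. (f (Suc i), f i) \<in> {(A, B). A \<in> L \<and> B \<in> L \<and> A \<subset> B}"
  then obtain f where f: "\<And>i. f i \<in> L" "\<And>i. f (Suc i) \<subset> f i"
    by blast
  have less: "f j \<subset> f i" if "i < j" for i j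
    using that f(2) by (induction rule: less_Suc_induct) auto
  have "inj f"
    by (metis injI less less_irrefl nat_neq_iff psubsetE order_refl)
  moreover have "range f \<in> chains L"
    unfolding chains_def chain_subset_def using f(1) less
    by (auto, metis nat_neq_iff psubsetE subsetD)
  ultimately show False
    using assms range_inj_infinite by blast
qed

section \<open>Adjacency and embedding criteria for \<open>G2\<close> and \<open>G3\<close>\<close>

lemma adjacent_commute: "adjacent G x y \<longleftrightarrow> adjacent G y x"
  by (simp add: adjacent_def insert_commute)

lemma adjacent_irrefl: "simple_graph G \<Longrightarrow> \<not> adjacent G x x"
  by (auto simp: adjacent_def simple_graph_def doubleton_eq_iff)

lemma mem_neighborhood_iff: "y \<in> neighborhood G x \<longleftrightarrow> y \<in> verts G \<and> adjacent G x y"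
  by (simp add: neighborhood_def adjacent_def)

lemma embedsI:
  assumes inj: "inj_on f (verts H)" and sub: "f ` verts H \<subseteq> verts G"
    and adj: "\<And>x y. x \<in> verts H \<Longrightarrow> y \<in> verts H \<Longrightarrow> adjacent H x y \<longleftrightarrow> adjacent G (f x) (f y)"
  shows "embeds G H"
  unfolding embeds_def graph_isomorphic_def
  using assms
  by (intro exI[of _ "f ` verts H"] conjI exI[of _ f])
     (auto simp: bij_betw_def induced_subgraph_def adjacent_def)

lemma embeds_G2I:
  assumes inj: "inj r" and sub: "range r \<subseteq> verts G"
    and adj: "\<And>i j. adjacent G (r i) (r j) \<longleftrightarrow> j = Suc i \<or> i = Suc j"
  shows "embeds G G2"
proof -
  \<comment> \<open>The path \<open>G2\<close> runs through \<open>VB 0\<close>,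
    \<open>VA 0\<close>, \<open>VB 1\<close>, \<open>VA 1\<close> and so on, hence the even and odd
    positions. \<open>VC\<close> is not a vertex of \<open>G2\<close>; its value is a dummy.\<close>
  define f where "f u = (case u of VA i \<Rightarrow> r (2 * i + 1) | VB i \<Rightarrow> r (2 * i) | VC \<Rightarrow> r 0)" for u
  have [simp]: "adjacent G2 (VA i) (VB j) \<longleftrightarrow> j = i \<or> j = Suc i"
    "adjacent G2 (VB j) (VA i) \<longleftrightarrow> j = i \<or> j = Suc i"
    "\<not> adjacent G2 (VA i) (VA j)" "\<not> adjacent G2 (VB i) (VB j)" for i j
    by (auto simp: adjacent_def G2_def doubleton_eq_iff)
  have verts: "verts G2 = range VA \<union> range VB"
    by (simp add: G2_def)
  have "inj_on f (verts G2)"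
    unfolding verts by (rule inj_onI) (auto simp: f_def inj_eq[OF inj], presburger+)
  moreover have "adjacent G2 u w \<longleftrightarrow> adjacent G (f u) (f w)" if "u \<in> verts G2" "w \<in> verts G2" for u w
    using that unfolding verts by (elim UnE rangeE; simp add: f_def adj; presburger?)
  ultimately show ?thesis
    using sub by (intro embedsI[of f]) (auto simp: f_def verts)
qed

lemma embeds_G3I:
  fixes a b :: "nat \<Rightarrow> 'v"
  assumes simple: "simple_graph G"
    and verts: "c \<in> verts G" "range a \<subseteq> verts G" "range b \<subseteq> verts G"
    and c: "\<And>i. adjacent G c (b i)" "\<And>i. \<not> adjacent G c (a i)"
    and ab: "\<And>i j. adjacent G (a i) (b j) \<longleftrightarrow> i = j"
    and indep: "\<And>i j. \<not> adjacent G (a i) (a j)" "\<And>i j. \<not> adjacent G (b i) (b j)"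
  shows "embeds G G3"
proof -
  define f where "f u = (case u of VA i \<Rightarrow> a i | VB i \<Rightarrow> b i | VC \<Rightarrow> c)" for u
  \<comment> \<open>Distinctness is read off from adjacency: equal vertices would have equal
    neighbors, and no vertex is adjacent to itself.\<close>
  have neq: "a i \<noteq> b j" "c \<noteq> a i" "c \<noteq> b i" for i j
    using ab[of i i] ab[of i "Suc i"] c(1)[of j] c(1)[of i] c(1)[of "Suc i"] indep(2)[of i j]
      indep(2)[of j i] adjacent_irrefl[OF simple] adjacent_commute[of G "b i" "b j"] by auto
  have inj: "a i = a j \<longleftrightarrow> i = j" "b i = b j \<longleftrightarrow> i = j" for i j
    using ab by metis+
  have adj: "adjacent G (b j) (a i) \<longleftrightarrow> i = j" "adjacent G (b i) c" "\<not> adjacent G (a i) c"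
    "\<not> adjacent G c c" for i j
    using ab c adjacent_commute[of G] adjacent_irrefl[OF simple] by metis+
  have [simp]: "adjacent G3 (VA i) (VB j) \<longleftrightarrow> i = j" "adjacent G3 (VB j) (VA i) \<longleftrightarrow> i = j"
    "adjacent G3 VC (VB i)" "adjacent G3 (VB i) VC" "\<not> adjacent G3 VC (VA i)" "\<not> adjacent G3 (VA i) VC"
    "\<not> adjacent G3 (VA i) (VA j)" "\<not> adjacent G3 (VB i) (VB j)" "\<not> adjacent G3 VC VC" for i j
    by (auto simp: adjacent_def G3_def doubleton_eq_iff)
  have verts_G3: "verts G3 = range VA \<union> range VB \<union> {VC}"
    by (simp add: G3_def)
  have "inj_on f (verts G3)"
    unfolding verts_G3 using neq neq[symmetric] by (intro inj_onI) (auto simp: f_def inj)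
  moreover have "adjacent G3 u w \<longleftrightarrow> adjacent G (f u) (f w)" if "u \<in> verts G3" "w \<in> verts G3" for u w
    using that unfolding verts_G3 by (auto simp: f_def c ab indep adj)
  ultimately show ?thesis
    using verts by (intro embedsI[of f]) (auto simp: f_def verts_G3)
qed

section \<open>The neighborhood lattice under the descending chain condition\<close>

text \<open>Intersecting the neighborhoods of \<open>p 0\<close>, \<open>p 1\<close> and so on one
  by one loses \<open>q n\<close> exactly when \<open>p n\<close> is added, so the intersections
  descend forever. The sequences may coincide, which also excludes infinite cliques.\<close>

lemma no_half_graph:
  fixes p q :: "nat \<Rightarrow> 'v"
  assumes wf: "wf {(A, B). A \<in> neighborhood_lattice G \<and> B \<in> neighborhood_lattice G \<and> A \<subset> B}"
    and verts: "range p \<subseteq> verts G" "range q \<subseteq> verts G"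
    and adj: "\<And>i j. i < j \<Longrightarrow> adjacent G (p i) (q j)" and nadj: "\<And>i. \<not> adjacent G (p i) (q i)"
  shows False
proof -
  define M where "M n = verts G \<inter> \<Inter> ((\<lambda>i. neighborhood G (p i)) ` {..<n})" for n :: nat
  have "M n \<in> neighborhood_lattice G" for n
    unfolding M_def neighborhood_lattice_def using verts by blast
  moreover have "M (Suc n) \<subset> M n" for n
  proof
    show "M (Suc n) \<subseteq> M n"
      by (auto simp: M_def)
    have "q n \<in> M n" "q n \<notin> M (Suc n)"
      using verts adj nadj[of n] by (auto simp: M_def mem_neighborhood_iff lessThan_Suc)
    then show "M (Suc n) \<noteq> M n"
      by blast
  qed
  ultimately show False
    using wf unfolding wf_iff_no_infinite_down_chain by blast
qed

text \<open>A minimal intersection of finitely many members of the family cannot shrink when one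
  more member is added, so it is already the whole intersection.\<close>

lemma neighborhood_lattice_finite_Inter:
  assumes wf: "wf {(A, B). A \<in> neighborhood_lattice G \<and> B \<in> neighborhood_lattice G \<and> A \<subset> B}"
    and P: "P \<in> neighborhood_lattice G"
  obtains X where "finite X" "X \<subseteq> verts G" "P = verts G \<inter> (\<Inter>x\<in>X. neighborhood G x)"
proof -
  obtain Y where Y: "Y \<subseteq> verts G" "P = verts G \<inter> (\<Inter>x\<in>Y. neighborhood G x)"
    using P unfolding neighborhood_lattice_def by (auto simp: subset_image_iff)
  define \<M> where "\<M> = {verts G \<inter> (\<Inter>x\<in>X. neighborhood G x) | X. finite X \<and> X \<subseteq> Y}"
  have "\<M> \<subseteq> neighborhood_lattice G"
    using Y unfolding \<M>_def neighborhood_lattice_def by blast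
  moreover have "verts G \<in> \<M>"
    unfolding \<M>_def by (rule CollectI, rule exI[of _ "{}"]) simp
  ultimately obtain M where M: "M \<in> \<M>" and min: "\<And>M'. M' \<in> \<M> \<Longrightarrow> \<not> M' \<subset> M"
    using wfE_min[OF wf, of "verts G" \<M>] by (smt (verit) case_prodI mem_Collect_eq subsetD)
  then obtain X where X: "finite X" "X \<subseteq> Y" "M = verts G \<inter> (\<Inter>x\<in>X. neighborhood G x)"
    unfolding \<M>_def by blast
  have "M \<subseteq> neighborhood G y" if "y \<in> Y" for y
  proof -
    have "verts G \<inter> (\<Inter>x\<in>insert y X. neighborhood G x) \<in> \<M>"
      unfolding \<M>_def using X that by blast
    then have "M \<inter> neighborhood G y \<in> \<M>"
      using X(3) by (simp add: Int_ac)
    then show ?thesis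
      using min by blast
  qed
  then have "M = P"
    using X Y by blast
  then show ?thesis
    using that X Y by blast
qed

text \<open>The lattice is closed under intersection with a neighborhood, so minimality of
  \<open>P\<close> among the infinite elements gives the dichotomy.\<close>

lemma minimal_infinite_neighborhood_set:
  assumes wf: "wf {(A, B). A \<in> neighborhood_lattice G \<and> B \<in> neighborhood_lattice G \<and> A \<subset> B}"
    and inf: "infinite (verts G)"
  obtains P where "P \<in> neighborhood_lattice G" "infinite P"
    "\<And>v. v \<in> verts G \<Longrightarrow> finite (P \<inter> neighborhood G v) \<or> P \<subseteq> neighborhood G v"
proof -
  have "verts G \<in> neighborhood_lattice G"
    unfolding neighborhood_lattice_def by (rule CollectI, rule exI[of _ "{}"]) simp
  then obtain P where P: "P \<in> neighborhood_lattice G" "infinite P"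
    and min: "\<And>A. A \<in> neighborhood_lattice G \<Longrightarrow> infinite A \<Longrightarrow> \<not> A \<subset> P"
    using wfE_min[OF wf, of "verts G" "{A \<in> neighborhood_lattice G. infinite A}"] inf
    by (smt (verit) case_prodI mem_Collect_eq)
  have "P \<inter> neighborhood G v \<in> neighborhood_lattice G" if v: "v \<in> verts G" for v
  proof -
    obtain F where "F \<subseteq> neighborhood G ` verts G" "P = verts G \<inter> \<Inter>F"
      using P(1) unfolding neighborhood_lattice_def by blast
    then show ?thesis
      unfolding neighborhood_lattice_def using v
      by (intro CollectI exI[of _ "insert (neighborhood G v) F"]) auto
  qed
  then show ?thesis
    using that[of P] P min by blast
qed

section \<open>Extraction of \<open>G3\<close> by greedy choice and Ramsey\<close>

text \<open>The finiteness assumptions allow a greedy sequence in which no term is adjacent to an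
  earlier term or to its \<open>v\<close>. Two uses of Ramsey then remove the edges from a later
  \<open>v\<close> to an earlier term and the edges among the \<open>v\<close>.\<close>

lemma embeds_G3_if_private_neighbors:
  assumes simple: "simple_graph G"
    and wf: "wf {(A, B). A \<in> neighborhood_lattice G \<and> B \<in> neighborhood_lattice G \<and> A \<subset> B}"
    and S: "infinite S" "S \<subseteq> verts G"
    and c: "c \<in> verts G" "\<And>x. x \<in> S \<Longrightarrow> adjacent G c x"
    and v: "\<And>x. x \<in> S \<Longrightarrow> v x \<in> verts G" "\<And>x. x \<in> S \<Longrightarrow> adjacent G (v x) x"
      "\<And>x. x \<in> S \<Longrightarrow> \<not> adjacent G c (v x)"
    and fin: "\<And>x. x \<in> S \<Longrightarrow> finite (S \<inter> neighborhood G x)"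
      "\<And>x. x \<in> S \<Longrightarrow> finite (S \<inter> neighborhood G (v x))"
  shows "embeds G G3"
proof -
  have ex: "\<exists>x. x \<in> S \<and> (\<forall>y\<in>A. \<not> adjacent G y x \<and> \<not> adjacent G (v y) x)"
    if A: "finite A" "A \<subseteq> S" for A
  proof -
    have "finite (\<Union>y\<in>A. S \<inter> neighborhood G y \<union> S \<inter> neighborhood G (v y))"
      using A fin by auto
    then obtain x where "x \<in> S" "x \<notin> (\<Union>y\<in>A. S \<inter> neighborhood G y \<union> S \<inter> neighborhood G (v y))"
      using S(1) by (meson finite_subset subsetI)
    then show ?thesis
      using S(2) by (auto simp: mem_neighborhood_iff)
  qed
  define good where "good A x \<longleftrightarrow> x \<in> S \<and> (\<forall>y\<in>A. \<not> adjacent G y x \<and> \<not> adjacent G (v y) x)" for A x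
  have "\<exists>s. \<forall>n::nat. good (s ` {..<n}) (s n)"
  proof -
    \<comment> \<open>The second disjunct provides a next value even after a sequence that has left
      \<open>S\<close>; the induction below shows that this never happens.\<close>
    have "\<exists>s. \<forall>n::nat. good (s ` {..<n}) (s n) \<or> \<not> s ` {..<n} \<subseteq> S"
    proof (rule dependent_wf_choice[OF wf_less])
      fix s s' :: "nat \<Rightarrow> 'a" and n x
      assume "\<And>i. (i, n) \<in> {(i, j). i < j} \<Longrightarrow> s i = s' i"
      then have "s ` {..<n} = s' ` {..<n}"
        by (intro image_cong) auto
      then show "(good (s ` {..<n}) x \<or> \<not> s ` {..<n} \<subseteq> S) = (good (s' ` {..<n}) x \<or> \<not> s' ` {..<n} \<subseteq> S)"
        by simp
    next
      show "\<exists>x. good (s ` {..<n}) x \<or> \<not> s ` {..<n} \<subseteq> S" for s :: "nat \<Rightarrow> 'a" and n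
        using ex[of "s ` {..<n}"] unfolding good_def by blast
    qed
    then obtain s where s: "\<And>n::nat. good (s ` {..<n}) (s n) \<or> \<not> s ` {..<n} \<subseteq> S"
      by blast
    have "s n \<in> S" for n
    proof (induction n rule: less_induct)
      case (less n)
      then show ?case using s[of n] by (auto simp: good_def)
    qed
    then show ?thesis
      using s by blast
  qed
  then obtain s where s: "\<And>n::nat. s n \<in> S"
    "\<And>i j. i < j \<Longrightarrow> \<not> adjacent G (s i) (s j)" "\<And>i j. i < j \<Longrightarrow> \<not> adjacent G (v (s i)) (s j)"
    unfolding good_def by blast
  obtain r :: "nat \<Rightarrow> nat" where r: "strict_mono r" "\<And>i j. i < j \<Longrightarrow> \<not> adjacent G (v (s (r j))) (s (r i))"
  proof (rule ramsey_subsequence[of "\<lambda>i j. adjacent G (v (s j)) (s i)"])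
    fix r :: "nat \<Rightarrow> nat" assume r: "strict_mono r" "\<forall>i j. i < j \<longrightarrow> adjacent G (v (s (r j))) (s (r i))"
    \<comment> \<open>Shifting the terms by one puts each edge between a term and its own
      \<open>v\<close> above the diagonal. The diagonal pairs a term with the \<open>v\<close> of an
      earlier one, which the greedy choice made nonadjacent.\<close>
    have False
    proof (rule no_half_graph[OF wf])
      show "adjacent G (s (r (Suc i))) (v (s (r j)))" if "i < j" for i j
        using that r(2) v(2)[OF s(1)] adjacent_commute[of G] by (cases "j = Suc i") auto
      show "\<not> adjacent G (s (r (Suc i))) (v (s (r i)))" for i
        using s(3) r(1) adjacent_commute[of G] by (metis lessI strict_mono_less)
    qed (use s(1) S(2) v(1) in auto)
    then show thesis ..
  qed (use that in blast)
  obtain t :: "nat \<Rightarrow> nat" where t: "strict_mono t" "\<And>i j. i < j \<Longrightarrow> \<not> adjacent G (v (s (r (t i)))) (v (s (r (t j))))"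
  proof (rule ramsey_subsequence[of "\<lambda>i j. adjacent G (v (s (r i))) (v (s (r j)))"])
    fix t :: "nat \<Rightarrow> nat" assume t: "\<forall>i j. i < j \<longrightarrow> adjacent G (v (s (r (t i)))) (v (s (r (t j))))"
    \<comment> \<open>A clique is a half graph with both sides equal, its diagonal being empty by
      irreflexivity.\<close>
    have False
      by (rule no_half_graph[OF wf, where p = "\<lambda>i. v (s (r (t i)))" and q = "\<lambda>i. v (s (r (t i)))"])
         (use t s(1) v(1) adjacent_irrefl[OF simple] in auto)
    then show thesis ..
  qed (use that in blast)
  define b where "b i = s (r (t i))" for i
  have mono: "r (t i) < r (t j)" if "i < j" for i j
    using r(1) t(1) that by (simp add: strict_mono_less)
  have b: "b i \<in> S" for i
    by (simp add: b_def s)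
  show ?thesis
  proof (rule embeds_G3I[OF simple c(1), of "\<lambda>i. v (b i)" b])
    show "adjacent G (v (b i)) (b j) \<longleftrightarrow> i = j" for i j
      using s(3)[OF mono, of i j] r(2)[of "t j" "t i"] strict_mono_less[OF t(1), of j i] v(2)[OF b]
      by (cases i j rule: linorder_cases) (auto simp: b_def)
    show "\<not> adjacent G (v (b i)) (v (b j))" for i j
      using t(2)[of i j] t(2)[of j i] adjacent_commute[of G] adjacent_irrefl[OF simple]
      by (cases i j rule: linorder_cases) (auto simp: b_def)
    show "\<not> adjacent G (b i) (b j)" for i j
      using s(2)[OF mono, of i j] s(2)[OF mono, of j i] adjacent_commute[of G] adjacent_irrefl[OF simple]
      by (cases i j rule: linorder_cases) (auto simp: b_def)
  qed (use b S(2) c v in auto)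
qed

section \<open>Consequences of primality\<close>

lemma infinite_outer_neighbors:
  assumes simple: "simple_graph G" and prime: "prime_graph G" and inf: "infinite (verts G)"
    and P: "P \<subseteq> verts G" "infinite P"
    and R: "R = {(x, y). x \<in> P \<and> y \<in> P \<and> adjacent G x y}"
    and fin: "\<And>x. x \<in> P \<Longrightarrow> finite (R\<^sup>* `` {x})"
  shows "infinite {x \<in> P. \<exists>v\<in>verts G - P. \<not> P \<subseteq> neighborhood G v \<and> adjacent G v x}"
    (is "infinite ?S")
proof
  assume "finite ?S"
  then have "finite (\<Union>s\<in>?S. R\<^sup>* `` {s})"
    using fin by auto
  \<comment> \<open>\<open>D\<close> collects the vertices whose component in \<open>P\<close>
    misses \<open>?S\<close>; only finitely many vertices are removed, since components are
    finite.\<close>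
  moreover define D where "D = P - (\<Union>s\<in>?S. R\<^sup>* `` {s})"
  ultimately have inf': "infinite D"
    using P(2) by simp
  have "sym R"
    unfolding R using adjacent_commute[of G] by (auto simp: sym_def)
  then have sym: "sym (R\<^sup>*)"
    by (rule sym_rtrancl)
  \<comment> \<open>A finite set cannot be all of the infinite \<open>verts G\<close>.\<close>
  have nontrivial: "\<exists>v. A = {v}" if "autonomous G A" "finite A" "A \<noteq> {}" for A
    using prime inf that unfolding prime_graph_def by blast
  have isolated: "x \<in> P \<and> x \<notin> ?S \<and> (\<forall>y\<in>P. \<not> adjacent G x y)"
    if x: "x \<in> D" for x
  proof -
    let ?C = "R\<^sup>* `` {x}"
    have x_P: "x \<in> P"
      using x by (simp add: D_def)
    have C_P: "?C \<subseteq> P"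
      using x by (auto elim: rtranclE simp: R D_def)
    have C_S: "?C \<inter> ?S = {}"
      using x sym by (auto dest: symD simp: D_def)
    \<comment> \<open>A vertex of \<open>P\<close> outside the component has no neighbor in it. A
      vertex outside \<open>P\<close> is adjacent to all of \<open>P\<close>, or to nothing in
      \<open>?C\<close> because \<open>?C\<close> misses \<open>?S\<close>.\<close>
    have "autonomous G ?C"
      unfolding autonomous_def
    proof (intro conjI ballI)
      show "?C \<subseteq> verts G"
        using C_P P(1) by blast
      fix v assume v: "v \<in> verts G - ?C"
      show "(\<forall>a\<in>?C. adjacent G v a) \<or> (\<forall>a\<in>?C. \<not> adjacent G v a)"
      proof (cases "v \<in> P")
        case True
        have "\<not> adjacent G v a" if a: "a \<in> ?C" for a
        proof
          assume "adjacent G v a"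
          then have "(a, v) \<in> R"
            using True a C_P adjacent_commute[of G] by (auto simp: R)
          then show False
            using a v by (auto intro: rtrancl_into_rtrancl)
        qed
        then show ?thesis by blast
      next
        case False
        show ?thesis
        proof (cases "P \<subseteq> neighborhood G v")
          case True
          then show ?thesis
            using C_P by (auto simp: mem_neighborhood_iff)
        next
          case nsub: False
          then show ?thesis
            using C_S C_P v False by blast
        qed
      qed
    qed
    moreover have "finite ?C"
      using x_P fin by simp
    moreover have "x \<in> ?C"
      by simp
    ultimately have "?C = {x}"
      using nontrivial[of ?C] by (metis empty_iff singletonD)
    have "y = x" if "y \<in> P" "adjacent G x y" for y
    proof -
      have "(x, y) \<in> R"
        using that x_P by (auto simp: R)
      then show ?thesis
        using \<open>?C = {x}\<close> by blast
    qed
    moreover have "\<not> adjacent G x x"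
      by (rule adjacent_irrefl[OF simple])
    ultimately show ?thesis
      using x_P C_S by blast
  qed
  obtain x where x: "x \<in> D"
    using inf' by (metis all_not_in_conv finite.emptyI)
  obtain y where y: "y \<in> D" "y \<noteq> x"
  proof -
    have "\<not> D \<subseteq> {x}"
      using inf' finite_subset by blast
    then show ?thesis
      using that by blast
  qed
  have "autonomous G {x, y}"
    unfolding autonomous_def
  proof (intro conjI ballI)
    show "{x, y} \<subseteq> verts G"
      using x y P(1) by (auto simp: D_def)
    fix v assume v: "v \<in> verts G - {x, y}"
    show "(\<forall>a\<in>{x, y}. adjacent G v a) \<or> (\<forall>a\<in>{x, y}. \<not> adjacent G v a)"
    proof (cases "v \<in> P")
      case True
      then show ?thesis
        using isolated[OF x] isolated[OF y(1)] adjacent_commute[of G] by blast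
    next
      case False
      then show ?thesis
        using isolated[OF x] isolated[OF y(1)] v
        by (cases "P \<subseteq> neighborhood G v") (auto simp: mem_neighborhood_iff)
    qed
  qed
  then show False
    using nontrivial[of "{x, y}"] y(2) by auto
qed

theorem theorem8:
  fixes G :: "'v graph"
  assumes "simple_graph G"
    and "infinite (verts G)"
    and "prime_graph G"
    and "\<And>C. C \<in> chains (neighborhood_lattice G) \<Longrightarrow> finite C"
  shows "embeds G G2 \<or> embeds G G3"
proof -
  note wf = wf_psubset_if_finite_chains[OF assms(4)]
  obtain P where P: "P \<in> neighborhood_lattice G" "infinite P"
    and min: "\<And>v. v \<in> verts G \<Longrightarrow> finite (P \<inter> neighborhood G v) \<or> P \<subseteq> neighborhood G v"
    using minimal_infinite_neighborhood_set[OF wf assms(2)] by blast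
  have PV: "P \<subseteq> verts G"
    using P(1) by (auto simp: neighborhood_lattice_def)
  have fin: "finite (P \<inter> neighborhood G x)" if "x \<in> P" for x
  proof -
    have "x \<notin> neighborhood G x"
      using adjacent_irrefl[OF assms(1)] by (simp add: mem_neighborhood_iff)
    then show ?thesis
      using min[of x] that PV by blast
  qed
  define R where "R = {(x, y). x \<in> P \<and> y \<in> P \<and> adjacent G x y}"
  show ?thesis
  proof (cases "\<forall>x\<in>P. finite (R\<^sup>* `` {x})")
    case False
    then obtain x where x: "x \<in> P" "infinite (R\<^sup>* `` {x})"
      by blast
    have "sym R" "irrefl R"
      using adjacent_commute[of G] adjacent_irrefl[OF assms(1)]
      by (auto simp: R_def sym_def irrefl_def)
    moreover have "finite (R `` {y})" for y
    proof (cases "y \<in> P")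
      case True
      then show ?thesis
        using PV by (intro finite_subset[OF _ fin[of y]]) (auto simp: R_def mem_neighborhood_iff)
    qed (simp add: R_def)
    ultimately obtain r :: "nat \<Rightarrow> 'v" where r: "inj r"
      "\<And>i j. (r i, r j) \<in> R \<longleftrightarrow> j = Suc i \<or> i = Suc j"
      using koenig_induced_ray[of R x] x(2) by blast
    have "r i \<in> P" for i
      using r(2)[of i "Suc i"] by (simp add: R_def)
    then have "embeds G G2"
      using r PV by (intro embeds_G2I[of r]) (auto simp: R_def)
    then show ?thesis ..
  next
    case True
    define S where "S = {x \<in> P. \<exists>v\<in>verts G - P. \<not> P \<subseteq> neighborhood G v \<and> adjacent G v x}"
    have "infinite S"
      unfolding S_def using infinite_outer_neighbors[OF assms(1,3,2) PV P(2) R_def] True by blast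
    obtain X where X: "finite X" "X \<subseteq> verts G" "P = verts G \<inter> (\<Inter>x\<in>X. neighborhood G x)"
      using neighborhood_lattice_finite_Inter[OF wf P(1)] by blast
    define w where "w c x v \<longleftrightarrow> v \<in> verts G \<and> \<not> P \<subseteq> neighborhood G v \<and> adjacent G v x
      \<and> \<not> adjacent G c v" for c x v
    \<comment> \<open>Since \<open>v\<close> lies outside \<open>P\<close>, it is missed by one of
      the finitely many neighborhoods whose intersection is \<open>P\<close>; the pigeonhole
      principle then fixes a single \<open>c\<close>.\<close>
    have "S \<subseteq> (\<Union>c\<in>X. {x \<in> P. \<exists>v. w c x v})"
    proof
      fix x assume "x \<in> S"
      then obtain v where v: "x \<in> P" "v \<in> verts G" "v \<notin> P" "\<not> P \<subseteq> neighborhood G v" "adjacent G v x"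
        by (auto simp: S_def)
      then obtain c where "c \<in> X" "\<not> adjacent G c v"
        using X(3) by (auto simp: mem_neighborhood_iff)
      then show "x \<in> (\<Union>c\<in>X. {x \<in> P. \<exists>v. w c x v})"
        using v by (auto simp: w_def)
    qed
    then obtain c where c: "c \<in> X" "infinite {x \<in> P. \<exists>v. w c x v}"
      using \<open>infinite S\<close> X(1) finite_subset by blast
    define T where "T = {x \<in> P. \<exists>v. w c x v}"
    obtain v where v: "\<And>x. x \<in> T \<Longrightarrow> w c x (v x)"
    proof
      show "w c x (SOME v. w c x v)" if "x \<in> T" for x
        using that by (auto simp: T_def intro: someI)
    qed
    have TP: "T \<subseteq> P"
      by (auto simp: T_def)
    have "embeds G G3"
    proof (rule embeds_G3_if_private_neighbors[OF assms(1) wf, of T c v])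
      show "infinite T"
        using c(2) by (simp add: T_def)
      show "finite (T \<inter> neighborhood G x)" if "x \<in> T" for x
        by (rule finite_subset[OF _ fin[of x]]) (use that TP in auto)
      show "finite (T \<inter> neighborhood G (v x))" if "x \<in> T" for x
      proof -
        \<comment> \<open>\<open>w\<close> records that \<open>v x\<close> is not adjacent to all of
          \<open>P\<close>, which leaves the finite alternative of \<open>min\<close>.\<close>
        have "finite (P \<inter> neighborhood G (v x))"
          using min[of "v x"] v[OF that] by (auto simp: w_def)
        then show ?thesis
          by (rule rev_finite_subset) (use TP in auto)
      qed
    qed (use TP PV c X v in \<open>auto simp: w_def mem_neighborhood_iff\<close>)
    then show ?thesis ..
  qed
qed

end
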